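(* Let $a_1,a_2,a_3$ be three non-collinear points, and let $L_1\equiv a_2a_3$, $L_2\equiv a_1a_3$, $L_3\equiv a_1a_2$, all assumed non-null. Suppose that the spreads $S_1\equiv S(L_2,L_3)$, $S_2\equiv S(L_1,L_3)$, $S_3\equiv S(L_1,L_2)$ satisfy $S_1=0$, $S_2=S\neq 0$ and $S_3=1$. Then exactly one of the three quadrances $q(a_2,a_3)$, $q(a_1,a_3)$, $q(a_1,a_2)$ is defined, namely $q_1\equiv q(a_2,a_3)$, and $$q_1=\frac{S-1}{S}.$$
   Context: Let $\mathbb F$ be a field of characteristic not two. A 3-proportion $x:y:z$ is a triple of elements of $\mathbb F$, not all zero, up to a common non-zero scalar. A point $a=[x:y:z]$ and a line $L=(l:m:n)$ are both 3-proportions. The point $[x:y:z]$ lies on the line $(l:m:n)$ when $lx+my-nz=0$. For distinct points $a,b$, the join $ab$ is the unique line through both. A point $[x:y:z]$ is null when $x^2+y^2-z^2=0$; a line $(l:m:n)$ is null when $l^2+m^2-n^2=0$. The quadrance between points $a_1=[x_1:y_1:z_1]$, $a_2=[x_2:y_2:z_2]$ is $$q(a_1,a_2)=1-\frac{(x_1x_2+y_1y_2-z_1z_2)^2}{(x_1^2+y_1^2-z_1^2)(x_2^2+y_2^2-z_2^2)};$$ it is defined precisely when both points are non-null. The spread between lines $L_1=(l_1:m_1:n_1)$, $L_2=(l_2:m_2:n_2)$ is $$S(L_1,L_2)=1-\frac{(l_1l_2+m_1m_2-n_1n_2)^2}{(l_1^2+m_1^2-n_1^2)(l_2^2+m_2^2-n_2^2)};$$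 it is defined precisely when both lines are non-null. *)

theory Defs
  imports Main
begin

text \<open>A partial equivalence: the zero triple is related to nothing, so it is excluded from the quotient.\<close>

definition proportional :: "'a::field \<times> 'a \<times> 'a \<Rightarrow> 'a \<times> 'a \<times> 'a \<Rightarrow> bool" where
  "proportional = (\<lambda>(x, y, z) (x', y', z').
     (x, y, z) \<noteq> (0, 0, 0) \<and> (\<exists>c. c \<noteq> 0 \<and> x' = c * x \<and> y' = c * y \<and> z' = c * z))"

lemma part_equivp_proportional: "part_equivp (proportional :: 'a::field \<times> 'a \<times> 'a \<Rightarrow> _)"
proof (rule part_equivpI)
  show "\<exists>t::'a \<times> 'a \<times> 'a. proportional t t"
    by (intro exI[of _ "(1, 0, 0)"]) (auto simp: proportional_def intro!: exI[of _ 1])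
  show "symp (proportional :: 'a \<times> 'a \<times> 'a \<Rightarrow> _)"
  proof (rule sympI)
    fix s t :: "'a \<times> 'a \<times> 'a"
    assume "proportional s t"
    moreover obtain x y z x' y' z' where st: "s = (x, y, z)" "t = (x', y', z')"
      by (cases s, cases t) auto
    ultimately obtain c where c: "(x, y, z) \<noteq> (0, 0, 0)" "c \<noteq> 0" "x' = c * x" "y' = c * y" "z' = c * z"
      by (auto simp: proportional_def)
    then show "proportional t s"
      by (auto simp: proportional_def st intro!: exI[of _ "inverse c"])
  qed
  show "transp (proportional :: 'a \<times> 'a \<times> 'a \<Rightarrow> _)"
  proof (rule transpI)
    fix s t u :: "'a \<times> 'a \<times> 'a"
    assume a: "proportional s t" "proportional t u"
    obtain x y z x' y' z' x'' y'' z'' where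
      stu: "s = (x, y, z)" "t = (x', y', z')" "u = (x'', y'', z'')"
      by (cases s, cases t, cases u) auto
    from a obtain c d where "(x, y, z) \<noteq> (0, 0, 0)"
      "c \<noteq> 0" "x' = c * x" "y' = c * y" "z' = c * z"
      "d \<noteq> 0" "x'' = d * x'" "y'' = d * y'" "z'' = d * z'"
      by (auto simp: proportional_def stu)
    then show "proportional s u"
      by (auto simp: proportional_def stu mult.assoc intro!: exI[of _ "d * c"])
  qed
qed

quotient_type (overloaded) 'a proportion = "'a::field \<times> 'a \<times> 'a" / partial: proportional
  by (rule part_equivp_proportional)

text \<open>Points and lines are both proportions; the synonyms only record the intended role.\<close>

type_synonym 'a hpoint = "'a proportion"
type_synonym 'a hline = "'a proportion"

lemma form_scale:
  fixes x1 :: "'a::field"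
  shows "(c * x1) * (d * x2) + (c * y1) * (d * y2) - (c * z1) * (d * z2)
    = (c * d) * (x1 * x2 + y1 * y2 - z1 * z2)"
  by (simp add: algebra_simps)

lemma qform_scale:
  fixes x :: "'a::field"
  shows "(c * x)\<^sup>2 + (c * y)\<^sup>2 - (c * z)\<^sup>2 = c\<^sup>2 * (x\<^sup>2 + y\<^sup>2 - z\<^sup>2)"
  by (simp add: algebra_simps power_mult_distrib)

lift_definition lies_on :: "'a::field hpoint \<Rightarrow> 'a hline \<Rightarrow> bool" is
  "\<lambda>(x, y, z) (l, m, n). l * x + m * y - n * z = 0"
  by (auto simp: proportional_def form_scale simp del: right_minus_eq)

lift_definition null_point :: "'a::field hpoint \<Rightarrow> bool" is
  "\<lambda>(x, y, z). x\<^sup>2 + y\<^sup>2 - z\<^sup>2 = 0"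
  by (auto simp: proportional_def qform_scale simp del: right_minus_eq)

lift_definition null_line :: "'a::field hline \<Rightarrow> bool" is
  "\<lambda>(l, m, n). l\<^sup>2 + m\<^sup>2 - n\<^sup>2 = 0"
  by (auto simp: proportional_def qform_scale simp del: right_minus_eq)

lemma ratio_scale:
  fixes b :: "'a::field"
  assumes "c \<noteq> 0" "d \<noteq> 0"
  shows "((c * d) * b)\<^sup>2 / ((c\<^sup>2 * p) * (d\<^sup>2 * q)) = b\<^sup>2 / (p * q)"
proof -
  have "((c * d) * b)\<^sup>2 / ((c\<^sup>2 * p) * (d\<^sup>2 * q)) = ((c * d)\<^sup>2 * b\<^sup>2) / ((c * d)\<^sup>2 * (p * q))"
    by (simp add: power_mult_distrib mult_ac)
  also have "\<dots> = b\<^sup>2 / (p * q)"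
    using assms by simp
  finally show ?thesis .
qed

text \<open>Quadrance and spread are partial: \<open>None\<close> means undefined.\<close>

lift_definition quadrance :: "'a::field hpoint \<Rightarrow> 'a hpoint \<Rightarrow> 'a option" is
  "\<lambda>(x1, y1, z1) (x2, y2, z2).
     if x1\<^sup>2 + y1\<^sup>2 - z1\<^sup>2 \<noteq> 0 \<and> x2\<^sup>2 + y2\<^sup>2 - z2\<^sup>2 \<noteq> 0
     then Some (1 - (x1 * x2 + y1 * y2 - z1 * z2)\<^sup>2
                    / ((x1\<^sup>2 + y1\<^sup>2 - z1\<^sup>2) * (x2\<^sup>2 + y2\<^sup>2 - z2\<^sup>2)))
     else None"
  by (auto simp: proportional_def form_scale qform_scale ratio_scale simp del: right_minus_eq)

lift_definition spread :: "'a::field hline \<Rightarrow> 'a hline \<Rightarrow> 'a option" is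
  "\<lambda>(l1, m1, n1) (l2, m2, n2).
     if l1\<^sup>2 + m1\<^sup>2 - n1\<^sup>2 \<noteq> 0 \<and> l2\<^sup>2 + m2\<^sup>2 - n2\<^sup>2 \<noteq> 0
     then Some (1 - (l1 * l2 + m1 * m2 - n1 * n2)\<^sup>2
                    / ((l1\<^sup>2 + m1\<^sup>2 - n1\<^sup>2) * (l2\<^sup>2 + m2\<^sup>2 - n2\<^sup>2)))
     else None"
  by (auto simp: proportional_def form_scale qform_scale ratio_scale simp del: right_minus_eq)

lemma quadrance_defined_iff: "quadrance a b \<noteq> None \<longleftrightarrow> \<not> null_point a \<and> \<not> null_point b"
  by transfer (auto split: if_splits)

lemma spread_defined_iff: "spread L M \<noteq> None \<longleftrightarrow> \<not> null_line L \<and> \<not> null_line M"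
  by transfer (auto split: if_splits)

lemma proportional_iff_cross:
  fixes x1 :: "'a::field"
  assumes "(x1, y1, z1) \<noteq> (0, 0, 0)" "(x2, y2, z2) \<noteq> (0, 0, 0)"
  shows "proportional (x1, y1, z1) (x2, y2, z2) \<longleftrightarrow>
    y1 * z2 = y2 * z1 \<and> z1 * x2 = z2 * x1 \<and> x1 * y2 = x2 * y1"
proof
  assume cr: "y1 * z2 = y2 * z1 \<and> z1 * x2 = z2 * x1 \<and> x1 * y2 = x2 * y1"
  consider "x1 \<noteq> 0" | "y1 \<noteq> 0" | "z1 \<noteq> 0" using assms(1) by auto
  then have "\<exists>c. x2 = c * x1 \<and> y2 = c * y1 \<and> z2 = c * z1"
  proof cases
    case 1
    then show ?thesis using cr by (intro exI[of _ "x2 / x1"]) (simp add: field_simps)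
  next
    case 2
    then show ?thesis using cr by (intro exI[of _ "y2 / y1"]) (simp add: field_simps)
  next
    case 3
    then show ?thesis using cr by (intro exI[of _ "z2 / z1"]) (simp add: field_simps)
  qed
  then show "proportional (x1, y1, z1) (x2, y2, z2)"
    using assms by (auto simp: proportional_def)
qed (auto simp: proportional_def)

lemma proportional_refl_iff:
  "proportional (x, y, z) (x, y, z) \<longleftrightarrow> (x, y, z) \<noteq> (0, 0, 0 :: 'a::field)"
  by (auto simp: proportional_def intro!: exI[of _ 1])

lemma ex1_join:
  fixes a b :: "'a::field hpoint"
  assumes "a \<noteq> b"
  shows "\<exists>!L. lies_on a L \<and> lies_on b L"
proof (rule ex_ex1I)
  show "\<exists>L. lies_on a L \<and> lies_on b L"
    using assms
  proof (transfer, clarify)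
    fix x1 y1 z1 x2 y2 z2 :: 'a
    assume "proportional (x1, y1, z1) (x1, y1, z1)" "proportional (x2, y2, z2) (x2, y2, z2)"
    then have nz: "(x1, y1, z1) \<noteq> (0, 0, 0)" "(x2, y2, z2) \<noteq> (0, 0, 0)"
      by (simp_all only: proportional_refl_iff not_False_eq_True)
    assume np: "\<not> proportional (x1, y1, z1) (x2, y2, z2)"
    let ?l = "y1 * z2 - y2 * z1" and ?m = "z1 * x2 - z2 * x1" and ?n = "x2 * y1 - x1 * y2"
    have "(?l, ?m, ?n) \<noteq> (0, 0, 0)"
      using np unfolding proportional_iff_cross[OF nz] by auto
    then have "proportional (?l, ?m, ?n) (?l, ?m, ?n)" by (simp only: proportional_refl_iff not_False_eq_True)
    then show "\<exists>L\<in>{t. proportional t t}.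
        (case L of (l, m, n) \<Rightarrow> l * x1 + m * y1 - n * z1 = 0) \<and>
        (case L of (l, m, n) \<Rightarrow> l * x2 + m * y2 - n * z2 = 0)"
      by (intro bexI[of _ "(?l, ?m, ?n)"]) (simp_all add: algebra_simps)
  qed
next
  fix L M :: "'a hline"
  assume "lies_on a L \<and> lies_on b L" "lies_on a M \<and> lies_on b M"
  then show "L = M" using assms
  proof (transfer, clarify)
    fix x1 y1 z1 x2 y2 z2 l m n l' m' n' :: 'a
    assume "proportional (x1, y1, z1) (x1, y1, z1)" "proportional (x2, y2, z2) (x2, y2, z2)"
      "proportional (l, m, n) (l, m, n)" "proportional (l', m', n') (l', m', n')"
    then have nz: "(x1, y1, z1) \<noteq> (0, 0, 0)" "(x2, y2, z2) \<noteq> (0, 0, 0)"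
      "(l, m, n) \<noteq> (0, 0, 0)" "(l', m', n') \<noteq> (0, 0, 0)"
      by (simp_all only: proportional_refl_iff not_False_eq_True)
    assume eqs: "l * x1 + m * y1 - n * z1 = 0" "l * x2 + m * y2 - n * z2 = 0"
      "l' * x1 + m' * y1 - n' * z1 = 0" "l' * x2 + m' * y2 - n' * z2 = 0"
    assume np: "\<not> proportional (x1, y1, z1) (x2, y2, z2)"
    have p00: "(m * n' - m' * n) * (y1 * z2 - y2 * z1) = 0" using eqs by algebra
    have p01: "(m * n' - m' * n) * (z1 * x2 - z2 * x1) = 0" using eqs by algebra
    have p02: "(m * n' - m' * n) * (x1 * y2 - x2 * y1) = 0" using eqs by algebra
    have p10: "(n * l' - n' * l) * (y1 * z2 - y2 * z1) = 0" using eqs by algebra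
    have p11: "(n * l' - n' * l) * (z1 * x2 - z2 * x1) = 0" using eqs by algebra
    have p12: "(n * l' - n' * l) * (x1 * y2 - x2 * y1) = 0" using eqs by algebra
    have p20: "(l * m' - l' * m) * (y1 * z2 - y2 * z1) = 0" using eqs by algebra
    have p21: "(l * m' - l' * m) * (z1 * x2 - z2 * x1) = 0" using eqs by algebra
    have p22: "(l * m' - l' * m) * (x1 * y2 - x2 * y1) = 0" using eqs by algebra
    show "proportional (l, m, n) (l', m', n')"
      using np p00 p01 p02 p10 p11 p12 p20 p21 p22
      unfolding proportional_iff_cross[OF nz(1,2)] proportional_iff_cross[OF nz(3,4)]
      by auto
  qed
qed

text \<open>For distinct points, \<open>THE\<close> is justified by \<open>ex1_join\<close>; for equal points \<open>join\<close> is unspecified.\<close>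

definition join :: "'a::field hpoint \<Rightarrow> 'a hpoint \<Rightarrow> 'a hline" where
  "join a b = (THE L. lies_on a L \<and> lies_on b L)"

definition collinear :: "'a::field hpoint \<Rightarrow> 'a hpoint \<Rightarrow> 'a hpoint \<Rightarrow> bool" where
  "collinear a b c \<longleftrightarrow> (\<exists>L. lies_on a L \<and> lies_on b L \<and> lies_on c L)"

end

theory Submission
  imports Defs
begin

text \<open>
  Represent the three lines by the cross products of representatives of the points, let \<open>A i j\<close> be
  their Gram matrix for the form \<open>x x' + y y' - z z'\<close>, and let \<open>D\<close> be the determinant of the three
  points. Up to the signs of off-diagonal entries, which depend on the orientation of the cross
  products, \<open>- D\<^sup>2\<close> times the Gram matrix of the points is the adjugate of \<open>A\<close>. Now \<open>S3 = 1\<close> means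
  \<open>A 1 2 = 0\<close>, and \<open>S1 = 0\<close> means \<open>A 2 2 * A 3 3 = (A 2 3)\<^sup>2\<close>, that is, the first point is null. The
  remaining entries of the adjugate are \<open>S * A 1 1 * A 3 3\<close>, \<open>A 1 1 * A 2 2\<close> and, up to sign,
  \<open>A 1 1 * A 2 3\<close>, which gives the quadrance \<open>1 - 1 / S\<close>.
\<close>

text \<open>The quotient is partial, and reflexivity of \<open>proportional\<close> at a triple is
  exactly non-vanishing, so any chosen representative is non-zero.\<close>

lemma proportion_cases:
  obtains x y z where "a = abs_proportion (x, y, z)" "(x, y, z) \<noteq> (0, 0, 0 :: 'a::field)"
proof -
  obtain x y z where r: "rep_proportion a = (x, y, z)" by (cases "rep_proportion a")
  have "proportional (x, y, z) (x, y, z)"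
    using Quotient3_rep_reflp[OF Quotient3_proportion, of a] by (simp add: r)
  moreover have "a = abs_proportion (x, y, z)"
    using Quotient3_abs_rep[OF Quotient3_proportion, of a] by (simp add: r)
  ultimately show ?thesis by (intro that) (simp_all only: proportional_refl_iff not_False_eq_True)
qed

lemma abs_proportion_eq_iff_cross:
  fixes x1 :: "'a::field"
  assumes "(x1, y1, z1) \<noteq> (0, 0, 0)" "(x2, y2, z2) \<noteq> (0, 0, 0)"
  shows "abs_proportion (x1, y1, z1) = abs_proportion (x2, y2, z2) \<longleftrightarrow>
    y1 * z2 = y2 * z1 \<and> z1 * x2 = z2 * x1 \<and> x1 * y2 = x2 * y1"
  using Quotient3_rel[OF Quotient3_proportion, of "(x1, y1, z1)" "(x2, y2, z2)"] assms
  by (simp add: proportional_refl_iff proportional_iff_cross)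

lemma lies_on_abs:
  assumes "(x, y, z) \<noteq> (0, 0, 0 :: 'a::field)" "(l, m, n) \<noteq> (0, 0, 0)"
  shows "lies_on (abs_proportion (x, y, z)) (abs_proportion (l, m, n)) \<longleftrightarrow> l * x + m * y - n * z = 0"
  using assms by (simp add: lies_on.abs_eq proportional_refl_iff)

lemma quadrance_abs:
  assumes "(x1, y1, z1) \<noteq> (0, 0, 0 :: 'a::field)" "(x2, y2, z2) \<noteq> (0, 0, 0)"
  shows "quadrance (abs_proportion (x1, y1, z1)) (abs_proportion (x2, y2, z2)) =
    (if x1\<^sup>2 + y1\<^sup>2 - z1\<^sup>2 \<noteq> 0 \<and> x2\<^sup>2 + y2\<^sup>2 - z2\<^sup>2 \<noteq> 0
     then Some (1 - (x1 * x2 + y1 * y2 - z1 * z2)\<^sup>2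
                    / ((x1\<^sup>2 + y1\<^sup>2 - z1\<^sup>2) * (x2\<^sup>2 + y2\<^sup>2 - z2\<^sup>2)))
     else None)"
  using assms by (simp only: quadrance.abs_eq proportional_refl_iff not_False_eq_True prod.case)

text \<open>Clearing denominators turns each spread hypothesis into a polynomial equation between
  entries of the Gram matrix.\<close>

lemma spread_abs_eq_Some_iff:
  assumes "(l1, m1, n1) \<noteq> (0, 0, 0 :: 'a::field)" "(l2, m2, n2) \<noteq> (0, 0, 0)"
  shows "spread (abs_proportion (l1, m1, n1)) (abs_proportion (l2, m2, n2)) = Some s \<longleftrightarrow>
    l1\<^sup>2 + m1\<^sup>2 - n1\<^sup>2 \<noteq> 0 \<and> l2\<^sup>2 + m2\<^sup>2 - n2\<^sup>2 \<noteq> 0 \<and>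
    (l1 * l2 + m1 * m2 - n1 * n2)\<^sup>2 = (1 - s) * ((l1\<^sup>2 + m1\<^sup>2 - n1\<^sup>2) * (l2\<^sup>2 + m2\<^sup>2 - n2\<^sup>2))"
proof -
  have "(if p \<noteq> 0 \<and> q \<noteq> 0 then Some (1 - b / (p * q)) else None) = Some s \<longleftrightarrow>
      p \<noteq> 0 \<and> q \<noteq> 0 \<and> b = (1 - s) * (p * q)" for b p q :: 'a
    by (auto simp: field_simps)
  then show ?thesis
    using assms by (simp only: spread.abs_eq proportional_refl_iff not_False_eq_True prod.case)
qed

lemma ex_line_through:
  fixes a b :: "'a::field hpoint"
  shows "\<exists>L. lies_on a L \<and> lies_on b L"
proof (cases "a = b")
  case True
  \<comment> \<open>Every point differs from at least one of these two, so the case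
    \<open>a = b\<close> reduces to a join of distinct points.\<close>
  have "abs_proportion (1, 0, 0) \<noteq> abs_proportion (0, 1, 0 :: 'a)"
    by (simp add: abs_proportion_eq_iff_cross)
  then obtain c where "a \<noteq> c" by metis
  then show ?thesis using ex1_join True by metis
qed (use ex1_join in blast)

text \<open>Two coinciding points would leave at most two to be covered by one line. Distinctness is
  what makes the three joins well specified.\<close>

lemma not_collinear_distinct:
  assumes "\<not> collinear a b c"
  shows "a \<noteq> b" "a \<noteq> c" "b \<noteq> c"
  using assms ex_line_through unfolding collinear_def by metis+

text \<open>\<open>v\<close> is the cross product with its last entry negated, because incidence
  subtracts the product of the third coordinates. It vanishes only for proportional triples.\<close>

lemma join_abs:
  fixes x1 :: "'a::field"
  defines "v \<equiv> \<lambda>x1 y1 z1 x2 y2 z2. (y1 * z2 - y2 * z1, z1 * x2 - z2 * x1, x2 * y1 - x1 * y2 :: 'a)"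
  assumes nz: "(x1, y1, z1) \<noteq> (0, 0, 0)" "(x2, y2, z2) \<noteq> (0, 0, 0)"
    and ne: "abs_proportion (x1, y1, z1) \<noteq> abs_proportion (x2, y2, z2)"
  shows "v x1 y1 z1 x2 y2 z2 \<noteq> (0, 0, 0)"
    and "join (abs_proportion (x1, y1, z1)) (abs_proportion (x2, y2, z2)) =
      abs_proportion (v x1 y1 z1 x2 y2 z2)"
proof -
  show v: "v x1 y1 z1 x2 y2 z2 \<noteq> (0, 0, 0)"
    using ne unfolding abs_proportion_eq_iff_cross[OF nz] v_def by auto
  show "join (abs_proportion (x1, y1, z1)) (abs_proportion (x2, y2, z2)) =
      abs_proportion (v x1 y1 z1 x2 y2 z2)"
    unfolding join_def
  proof (rule the1_equality[OF ex1_join[OF ne]])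
    show "lies_on (abs_proportion (x1, y1, z1)) (abs_proportion (v x1 y1 z1 x2 y2 z2)) \<and>
      lies_on (abs_proportion (x2, y2, z2)) (abs_proportion (v x1 y1 z1 x2 y2 z2))"
      unfolding v_def lies_on_abs[OF nz(1) v[unfolded v_def]] lies_on_abs[OF nz(2) v[unfolded v_def]]
      by (simp add: algebra_simps)
  qed
qed

lemma not_collinear_not_lies_on_join:
  assumes "\<not> collinear a b c"
  shows "\<not> lies_on a (join b c)"
  using theI'[OF ex1_join[OF not_collinear_distinct(3)[OF assms]]] assms
  unfolding collinear_def join_def by blast

theorem theorem64:
  fixes a1 a2 a3 :: "'a::field hpoint"
    and L1 L2 L3 :: "'a hline"
    and S1 S2 S3 S :: 'a
  assumes "CHAR('a) \<noteq> 2"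
    and "\<not> collinear a1 a2 a3"
    and "L1 = join a2 a3" and "L2 = join a1 a3" and "L3 = join a1 a2"
    and "\<not> null_line L1" and "\<not> null_line L2" and "\<not> null_line L3"
    and "spread L2 L3 = Some S1" and "spread L1 L3 = Some S2" and "spread L1 L2 = Some S3"
    and "S1 = 0" and "S2 = S" and "S \<noteq> 0" and "S3 = 1"
  shows "quadrance a1 a3 = None \<and> quadrance a1 a2 = None \<and>
    quadrance a2 a3 = Some ((S - 1) / S)"
proof -
  obtain x1 y1 z1 where a1: "a1 = abs_proportion (x1, y1, z1)" "(x1, y1, z1) \<noteq> (0, 0, 0)"
    by (rule proportion_cases)
  obtain x2 y2 z2 where a2: "a2 = abs_proportion (x2, y2, z2)" "(x2, y2, z2) \<noteq> (0, 0, 0)"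
    by (rule proportion_cases)
  obtain x3 y3 z3 where a3: "a3 = abs_proportion (x3, y3, z3)" "(x3, y3, z3) \<noteq> (0, 0, 0)"
    by (rule proportion_cases)
  note distinct = not_collinear_distinct[OF assms(2), unfolded a1(1) a2(1) a3(1)]
  define l1 m1 n1 where v1: "l1 = y2 * z3 - y3 * z2" "m1 = z2 * x3 - z3 * x2" "n1 = x3 * y2 - x2 * y3"
  define l2 m2 n2 where v2: "l2 = y1 * z3 - y3 * z1" "m2 = z1 * x3 - z3 * x1" "n2 = x3 * y1 - x1 * y3"
  define l3 m3 n3 where v3: "l3 = y1 * z2 - y2 * z1" "m3 = z1 * x2 - z2 * x1" "n3 = x2 * y1 - x1 * y2"
  have L1: "(l1, m1, n1) \<noteq> (0, 0, 0)" "L1 = abs_proportion (l1, m1, n1)"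
    using join_abs[OF a2(2) a3(2) distinct(3)] unfolding assms(3) a2(1) a3(1) v1 by blast+
  have L2: "(l2, m2, n2) \<noteq> (0, 0, 0)" "L2 = abs_proportion (l2, m2, n2)"
    using join_abs[OF a1(2) a3(2) distinct(2)] unfolding assms(4) a1(1) a3(1) v2 by blast+
  have L3: "(l3, m3, n3) \<noteq> (0, 0, 0)" "L3 = abs_proportion (l3, m3, n3)"
    using join_abs[OF a1(2) a2(2) distinct(1)] unfolding assms(5) a1(1) a2(1) v3 by blast+
  \<comment> \<open>The sign in \<open>n1\<close> cancels the one in the incidence form, so
    \<open>D\<close> is the determinant of the three triples; it is non-zero because
    \<open>a1\<close> is not on \<open>L1\<close>.\<close>
  define D where "D = l1 * x1 + m1 * y1 - n1 * z1"
  have D: "D \<noteq> 0"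
    using not_collinear_not_lies_on_join[OF assms(2)] lies_on_abs[OF a1(2) L1(1)]
    unfolding D_def assms(3)[symmetric] a1(1) L1(2) by blast
  define A11 A22 A33 where A: "A11 = l1\<^sup>2 + m1\<^sup>2 - n1\<^sup>2" "A22 = l2\<^sup>2 + m2\<^sup>2 - n2\<^sup>2" "A33 = l3\<^sup>2 + m3\<^sup>2 - n3\<^sup>2"
  define A12 A13 A23 where B: "A12 = l1 * l2 + m1 * m2 - n1 * n2" "A13 = l1 * l3 + m1 * m3 - n1 * n3"
    "A23 = l2 * l3 + m2 * m3 - n2 * n3"
  define g11 g22 g33 g23 where g: "g11 = x1\<^sup>2 + y1\<^sup>2 - z1\<^sup>2" "g22 = x2\<^sup>2 + y2\<^sup>2 - z2\<^sup>2"
    "g33 = x3\<^sup>2 + y3\<^sup>2 - z3\<^sup>2" "g23 = x2 * x3 + y2 * y3 - z2 * z3"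
  have "A22 \<noteq> 0 \<and> A33 \<noteq> 0 \<and> A23\<^sup>2 = (1 - S1) * (A22 * A33)"
    and "A11 \<noteq> 0 \<and> A33 \<noteq> 0 \<and> A13\<^sup>2 = (1 - S2) * (A11 * A33)"
    and "A11 \<noteq> 0 \<and> A22 \<noteq> 0 \<and> A12\<^sup>2 = (1 - S3) * (A11 * A22)"
    using assms(9-11) unfolding L1(2) L2(2) L3(2) spread_abs_eq_Some_iff[OF L2(1) L3(1)]
      spread_abs_eq_Some_iff[OF L1(1) L3(1)] spread_abs_eq_Some_iff[OF L1(1) L2(1)] A B
    by blast+
  then have nz: "A11 \<noteq> 0" "A22 \<noteq> 0" "A33 \<noteq> 0"
    and s: "A23\<^sup>2 = A22 * A33" "A13\<^sup>2 = (1 - S) * (A11 * A33)" "A12 = 0"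
    using assms(12-15) by auto
  have "D\<^sup>2 * g11 = A23\<^sup>2 - A22 * A33" "D\<^sup>2 * g22 = A13\<^sup>2 - A11 * A33" "D\<^sup>2 * g33 = A12\<^sup>2 - A11 * A22"
    unfolding D_def g A B v1 v2 v3 by algebra+
  with s have G: "D\<^sup>2 * g11 = 0" "D\<^sup>2 * g22 = - (S * A11 * A33)" "D\<^sup>2 * g33 = - (A11 * A22)"
    by algebra+
  \<comment> \<open>\<open>L2\<close> comes from \<open>a1\<close>, \<open>a3\<close> rather than
    the cyclic order \<open>a3\<close>, \<open>a1\<close>; this negates \<open>A12\<close> and
    \<open>A23\<close>, hence the whole right-hand side.\<close>
  have "D\<^sup>2 * g23 = A12 * A13 - A11 * A23"
    unfolding D_def g A B v1 v2 v3 by algebra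
  with s have G': "D\<^sup>2 * g23 = - (A11 * A23)" by simp
  have gnz: "g11 = 0" "g22 \<noteq> 0" "g33 \<noteq> 0"
    using G D nz \<open>S \<noteq> 0\<close> by auto
  \<comment> \<open>Both sides equal \<open>S * A11\<^sup>2 * A22 * A33\<close>, the left one
    because \<open>A23\<^sup>2 = A22 * A33\<close>.\<close>
  have "(D\<^sup>2)\<^sup>2 * (S * g23\<^sup>2) = (D\<^sup>2)\<^sup>2 * (g22 * g33)"
    using G G' s(1) by algebra
  then have "S * g23\<^sup>2 = g22 * g33" using D by simp
  then have "1 - g23\<^sup>2 / (g22 * g33) = (S - 1) / S"
    using gnz \<open>S \<noteq> 0\<close> by (simp add: field_simps)
  \<comment> \<open>Since \<open>g11 = 0\<close>, the point \<open>a1\<close> is null, so both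
    quadrances involving it are \<open>None\<close>.\<close>
  then show ?thesis
    unfolding a1(1) a2(1) a3(1) quadrance_abs[OF a1(2) a3(2)] quadrance_abs[OF a1(2) a2(2)]
      quadrance_abs[OF a2(2) a3(2)] g[symmetric]
    using gnz by simp
qed

end
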